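(* Let $n,k\geq 1$ with $\gcd(n,k)=s$ and $n/s$ odd. Let $r$ be the least positive residue of $n$ modulo $2k$. Then the following hold. (a) $$\mathrm{Inv}_{2^k+1}(n) = \mathrm{Inv}_{2^k+1}(r)\cdot 2^{n-r} + \left(\frac{(2^k+1)\cdot\mathrm{Inv}_{2^k+1}(r)-1}{2^r-1}-1\right)(2^k-1)\,\frac{2^{n-r}-1}{2^{2k}-1}.$$ (b) Let $\boldsymbol{g_n}$ be the binary sequence of length $n$ representing $\mathrm{Inv}_{2^k+1}(n)$; let $\boldsymbol{w_k}$ be the binary sequence of length $k$ representing $\frac{(2^k+1)\cdot\mathrm{Inv}_{2^k+1}(r)-1}{2^r-1}-2$; and let $\boldsymbol{a_r}$ be the binary sequence of length $r$ representing $\mathrm{Inv}_{2^k+1}(r)$. Then $\boldsymbol{g_n}$ is obtained by concatenating the sequences $\boldsymbol{a_r}$, $\boldsymbol{w_k}$ and $\boldsymbol{\bar w_k}$ as follows: $$\boldsymbol{g_n} = \boldsymbol{a_r}\,|\,\boldsymbol{w_k}\,|\,\boldsymbol{\bar w_k}\,|\,\ldots\,|\,\boldsymbol{w_k}\,|\,\boldsymbol{\bar w_k},$$ where the block $\boldsymbol{w_k}\,|\,\boldsymbol{\bar w_k}$ occurs $\frac{n-r}{2k}$ times. In particular, $\mathrm{wt}(\boldsymbol{g_n})=\mathrm{wt}(\boldsymbol{a_r})+\frac{n-r}{2}$. (c) The binary weight of $\mathrm{Inv}_{2^k+1}(n)$ is $$\frac{n-s}{2}+1=\frac{n-s+2}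{2}.$$
   Context: For a positive integer $d$ and $n\ge 1$ with $\gcd(d,2^n-1)=1$, $\mathrm{Inv}_d(n)$ denotes the least positive residue of the inverse of $d$ modulo $2^n-1$, i.e. the smallest positive integer $t$ with $d\cdot t\equiv 1 \pmod{2^n-1}$; thus $0<\mathrm{Inv}_d(n)<2^n-1$ for $n\ge 2$, and $\mathrm{Inv}_d(1)=1$. (It is known that $\gcd(2^k+1,2^n-1)=1$ if and only if $n/\gcd(n,k)$ is odd.) The binary sequence of length $\ell$ representing an integer $0\le v<2^\ell$ is $v_{\ell-1}\ldots v_1v_0$ with $v=\sum_{i=0}^{\ell-1}v_i2^i$, $v_i\in\{0,1\}$ (most significant bit first, padded with leading zeros). The complementary sequence $\boldsymbol{\bar a}$ of a binary sequence $\boldsymbol{a}$ is obtained by flipping every bit. $\boldsymbol{a}\,|\,\boldsymbol{b}$ denotes concatenation. The binary weight $\mathrm{wt}$ of a sequence (or of a nonnegative integer) is the number of ones in it (in its binary representation). *)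

theory Defs
  imports Complex_Main "HOL-Number_Theory.Cong"
begin

definition Inv :: "nat \<Rightarrow> nat \<Rightarrow> nat" where
  "Inv d n = (LEAST t. 0 < t \<and> [d * t = 1] (mod (2 ^ n - 1)))"

text \<open>The list \<open>v\<close> has the most significant bit first. The represented value is a real number so that
  it can be given by an expression with exact subtraction and division; a representation exists only
  if that value is an integer in the range from 0 to \<open>2 ^ l - 1\<close>, and it is then unique.\<close>

definition represents :: "bool list \<Rightarrow> nat \<Rightarrow> real \<Rightarrow> bool" where
  "represents v l x \<longleftrightarrow> length v = l \<and> x = (\<Sum>i<l. of_bool (v ! (l - 1 - i)) * 2 ^ i)"

definition complement :: "bool list \<Rightarrow> bool list" where
  "complement v = map Not v"

definition wt_seq :: "bool list \<Rightarrow> nat" where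
  "wt_seq v = count_list v True"

definition wt :: "nat \<Rightarrow> nat" where
  "wt x = card {i. bit x i}"

end

theory Submission
  imports Defs
begin

text \<open>
  Write \<open>M = 2 ^ n - 1\<close> and \<open>y = 2 ^ k\<close>. Modulo \<open>M\<close> the exponents of powers of two only matter
  modulo \<open>n\<close>, so a number below \<open>2 ^ n\<close> is the same thing as a set of bit positions in \<open>Z/n\<close>,
  and multiplication by \<open>y\<close> shifts all positions by \<open>k\<close>.

  The weight comes from an explicit inverse. The shift by \<open>k\<close> splits \<open>Z/n\<close> into \<open>s\<close> cycles of odd
  length \<open>N = n / s\<close>, with positions \<open>j + k * m\<close> for \<open>j < s\<close> and \<open>m < N\<close>. On the cycle of
  \<open>j = s - 1\<close> put a one wherever \<open>m\<close> is even, on all other cycles wherever \<open>m\<close> is odd. Adding this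
  number to its shift by \<open>k\<close> gives every position once, except that position \<open>s - 1\<close> is hit twice
  and the positions \<open>0, \<dots>, s - 2\<close> are not hit. The total is therefore
  \<open>M + 2 ^ (s - 1) - (2 ^ (s - 1) - 1) = M + 1\<close> up to multiples of \<open>M\<close>, so this number is the
  inverse of \<open>y + 1\<close>, and its ones can be counted
  (\<open>inverse_of_known_weight\<close>).

  The relation between \<open>n\<close> and \<open>r\<close> is an identity with a uniqueness argument. For the inverse \<open>a\<close>
  belonging to \<open>r\<close>, the quotient \<open>Q\<close> in \<open>(2 ^ k + 1) * a = 1 + Q * (2 ^ r - 1)\<close> is exactly the
  quantity \<open>q\<close>. The right-hand side \<open>X\<close> of the closed formula satisfies
  \<open>(2 ^ k + 1) * X = 1 + Q * (2 ^ n - 1)\<close> with the \<^emph>\<open>same\<close> quotient; since \<open>Q \<le> 2 ^ k\<close>, it lies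
  in the range \<open>1, \<dots>, 2 ^ n - 1\<close> and must be the least positive inverse (\<open>Inv_eqI\<close>). Also \<open>Q \<ge> 2\<close>, so
  \<open>Q - 2\<close> has \<open>k\<close> binary digits \<open>w\<close>. The block consisting of \<open>w\<close> and its complement has the value
  \<open>(Q - 2) * 2 ^ k + (2 ^ k - 1 - (Q - 2)) = (Q - 1) * (2 ^ k - 1)\<close>, and repeating it produces
  the geometric sum in the formula: the digits of \<open>X\<close> are those of \<open>a\<close> followed by such blocks.
\<close>

section \<open>Least positive inverses\<close>

text \<open>
  Each residue class has only one representative in \<open>1, \<dots>, 2 ^ n - 1\<close>. The upper end is
  included because for \<open>n = 1\<close> the modulus and the inverse are both \<open>1\<close>.
\<close>

lemma Inv_eqI:
  assumes "0 < t" "t \<le> 2 ^ n - 1" and cong: "[d * t = 1] (mod (2 ^ n - 1))"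
  shows "Inv d n = t"
  unfolding Inv_def
proof (rule Least_equality)
  show "0 < t \<and> [d * t = 1] (mod (2 ^ n - 1))"
    using assms by simp
next
  fix u assume u: "0 < u \<and> [d * u = 1] (mod (2 ^ n - 1))"
  have "coprime d (2 ^ n - 1)"
    using cong coprime_iff_invertible_nat by (metis One_nat_def)
  moreover have "[d * u = d * t] (mod (2 ^ n - 1))"
    using u cong cong_sym cong_trans by blast
  ultimately have "[u = t] (mod (2 ^ n - 1))"
    by (simp add: cong_mult_lcancel_nat)
  show "t \<le> u"
  proof (rule ccontr)
    assume "\<not> t \<le> u"
    then have "2 ^ n - 1 dvd t - u"
      using \<open>[u = t] (mod (2 ^ n - 1))\<close> by (simp add: cong_altdef_nat cong_sym_eq)
    then have "2 ^ n - 1 \<le> t - u"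
      using \<open>\<not> t \<le> u\<close> by (intro dvd_imp_le) auto
    then show False
      using u assms(2) \<open>\<not> t \<le> u\<close> by linarith
  qed
qed

section \<open>Sums of distinct powers of two\<close>

lemma bit_sum_powers_of_two:
  fixes B :: "nat set"
  assumes "B \<subseteq> {..<n}"
  shows "bit (\<Sum>i\<in>B. (2::nat) ^ i) p \<longleftrightarrow> p \<in> B"
proof -
  let ?bs = "map (\<lambda>i. i \<in> B) [0..<n]"
  have "(\<Sum>i\<in>B. (2::nat) ^ i) = (\<Sum>i\<in>{0..<n}. if i \<in> B then 2 ^ i else 0)"
    using assms by (subst sum.inter_restrict [symmetric]) (auto intro!: sum.cong)
  also have "\<dots> = (\<Sum>i = 0..<length ?bs. of_bool (?bs ! i) * 2 ^ i)"
    by (intro sum.cong) auto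
  also have "\<dots> = horner_sum of_bool 2 ?bs"
    by (rule horner_sum_eq_sum [symmetric])
  finally show ?thesis
    using assms by (auto simp: bit_horner_sum_bit_iff)
qed

lemma wt_sum_powers_of_two:
  assumes "B \<subseteq> {..<n}"
  shows "wt (\<Sum>i\<in>B. 2 ^ i) = card B"
  by (simp add: wt_def bit_sum_powers_of_two [OF assms])

lemma sum_powers_of_two_le:
  assumes "B \<subseteq> {..<n}"
  shows "(\<Sum>i\<in>B. (2::nat) ^ i) \<le> 2 ^ n - 1"
proof -
  have "(\<Sum>i\<in>B. (2::nat) ^ i) \<le> (\<Sum>i\<in>{..<n}. 2 ^ i)"
    using assms by (intro sum_mono2) auto
  also have "\<dots> = 2 ^ n - 1"
    using mask_eq_sum_exp_nat [of n] by (simp add: lessThan_def)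
  finally show ?thesis .
qed

text \<open>Since \<open>2 ^ n \<equiv> 1\<close>, multiplying by a power of two rotates the \<open>n\<close> bit positions.\<close>

lemma cong_two_power_mod: "[2 ^ e = 2 ^ (e mod n)] (mod (2 ^ n - 1 :: int))"
proof -
  have "[(2::int) ^ n = 1] (mod 2 ^ n - 1)"
    by (simp add: cong_iff_dvd_diff)
  then have "[((2::int) ^ n) ^ (e div n) * 2 ^ (e mod n) = 1 ^ (e div n) * 2 ^ (e mod n)] (mod 2 ^ n - 1)"
    by (intro cong_mult cong_pow cong_refl)
  then show ?thesis
    by (simp flip: power_mult power_add)
qed

section \<open>The inverse as a set of bit positions\<close>

text \<open>
  The multiples of \<open>k\<close> form the subgroup of \<open>Z/n\<close> generated by \<open>s\<close>, which has order \<open>n div s\<close>; its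
  cosets are represented by \<open>0, \<dots>, s - 1\<close>. So \<open>j\<close> is recovered modulo \<open>s\<close>, and \<open>m\<close> is then recovered
  modulo \<open>n div s\<close> because \<open>k div s\<close> is invertible there. Surjectivity follows by counting.
\<close>

lemma bij_betw_cosets:
  fixes n k :: nat
  assumes "n \<ge> 1"
  defines "s \<equiv> gcd n k"
  shows "bij_betw (\<lambda>(j, m). (j + k * m) mod n) ({..<s} \<times> {..<n div s}) {..<n}"
proof -
  have "s > 0" using assms by simp
  have inj: "inj_on (\<lambda>(j, m). (j + k * m) mod n) ({..<s} \<times> {..<n div s})"
  proof (rule inj_onI, clarsimp)
    fix j m j' m'
    assume lt: "j < s" "m < n div s" "j' < s" "m' < n div s"
      and "(j + k * m) mod n = (j' + k * m') mod n"
    then have c: "[j + k * m = j' + k * m'] (mod n)" by (simp add: cong_def)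
    then have "[j + k * m = j' + k * m'] (mod s)"
      by (rule cong_dvd_modulus_nat) (simp add: s_def)
    moreover have "(i + k * l) mod s = i mod s" for i l
    proof -
      have "k * l mod s = 0" by (simp add: s_def)
      then show ?thesis by (metis mod_add_right_eq add_0_right)
    qed
    ultimately have "j mod s = j' mod s" by (simp add: cong_def)
    with lt have j: "j = j'" by simp
    with c have "[k * m = k * m'] (mod n)" by (simp add: cong_add_lcancel_nat)
    then have "[(k div s) * m = (k div s) * m'] (mod (n div s))"
    proof -
      have eq: "k * m = s * ((k div s) * m)" "k * m' = s * ((k div s) * m')" "n = s * (n div s)"
        by (simp_all add: s_def)
      have "s * ((k div s) * m mod (n div s)) = s * ((k div s) * m' mod (n div s))"
        using \<open>[k * m = k * m'] (mod n)\<close> unfolding cong_def mult_mod_right eq [symmetric] .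
      with \<open>s > 0\<close> show ?thesis by (simp add: cong_def)
    qed
    moreover have "coprime (k div s) (n div s)"
      unfolding s_def using assms(1) by (metis coprime_commute div_gcd_coprime not_one_le_zero)
    ultimately have "[m = m'] (mod (n div s))" by (simp add: cong_mult_lcancel_nat)
    with lt have "m = m'" by (simp add: cong_less_modulus_unique_nat)
    with j show "j = j' \<and> m = m'" by simp
  qed
  moreover have "(\<lambda>(j, m). (j + k * m) mod n) ` ({..<s} \<times> {..<n div s}) = {..<n}"
  proof (rule card_subset_eq)
    show "card ((\<lambda>(j, m). (j + k * m) mod n) ` ({..<s} \<times> {..<n div s})) = card {..<n}"
      by (subst card_image [OF inj]) (simp add: s_def)
  qed (use assms(1) in auto)
  ultimately show ?thesis by (simp add: bij_betw_def)
qed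

text \<open>
  Multiplying by \<open>y + 1\<close> fills in the missing neighbour \<open>y ^ (m + 1)\<close> of every \<open>y ^ m\<close>: the even
  exponents \<open>0, \<dots>, 2 * h\<close> yield all of \<open>0, \<dots>, 2 * h + 1\<close>, and the odd ones yield \<open>1, \<dots>, 2 * h\<close>.
  Modulo a number for which \<open>y ^ (2 * h + 1) \<equiv> 1\<close>, the results are one more and one less than the
  full geometric sum.
\<close>

lemma alternating_geometric_sums:
  fixes y :: int
  shows "(y + 1) * (\<Sum>m\<in>{m. m < 2 * h + 1 \<and> even m}. y ^ m) = (\<Sum>m<2 * h + 1. y ^ m) + y ^ (2 * h + 1)"
    and "(y + 1) * (\<Sum>m\<in>{m. m < 2 * h + 1 \<and> odd m}. y ^ m) = (\<Sum>m<2 * h + 1. y ^ m) - 1"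
proof -
  have filter: "(\<Sum>m\<in>{m. m < N \<and> P m}. y ^ m) = (\<Sum>m<N. if P m then y ^ m else 0)" for N P
    by (subst sum.inter_filter [symmetric]) (auto intro: sum.cong)
  have "(y + 1) * (\<Sum>m<2 * h + 1. if even m then y ^ m else 0) = (\<Sum>m<2 * h + 1. y ^ m) + y ^ (2 * h + 1)
      \<and> (y + 1) * (\<Sum>m<2 * h + 1. if odd m then y ^ m else 0) = (\<Sum>m<2 * h + 1. y ^ m) - 1"
    by (induction h) (simp_all add: algebra_simps)
  then show "(y + 1) * (\<Sum>m\<in>{m. m < 2 * h + 1 \<and> even m}. y ^ m) = (\<Sum>m<2 * h + 1. y ^ m) + y ^ (2 * h + 1)"
    and "(y + 1) * (\<Sum>m\<in>{m. m < 2 * h + 1 \<and> odd m}. y ^ m) = (\<Sum>m<2 * h + 1. y ^ m) - 1"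
    unfolding filter by simp_all
qed

lemma card_even_odd_below:
  "card {m. m < 2 * h + 1 \<and> even m} = h + 1"
  "card {m. m < 2 * h + 1 \<and> odd m} = h"
proof -
  have "{m. m < 2 * h + 1 \<and> even m} = (*) 2 ` {..h}" by (auto elim!: evenE)
  then show "card {m. m < 2 * h + 1 \<and> even m} = h + 1" by (simp add: card_image inj_on_def)
  have "{m. m < 2 * h + 1 \<and> odd m} = (\<lambda>i. 2 * i + 1) ` {..<h}" by (auto elim!: oddE)
  then show "card {m. m < 2 * h + 1 \<and> odd m} = h" by (simp add: card_image inj_on_def)
qed

text \<open>
  The cycle of \<open>s - 1\<close> contributes its even steps \<open>E\<close> and every other cycle its odd steps \<open>D\<close>. After
  multiplication by \<open>2 ^ k + 1\<close> each cycle is complete, and all complete cycles together are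
  \<open>2 ^ n - 1 \<equiv> 0\<close>. What remains is an excess of \<open>2 ^ (s - 1)\<close> from the first kind and a deficit
  of \<open>2 ^ 0 + \<dots> + 2 ^ (s - 2) = 2 ^ (s - 1) - 1\<close> from the second, that is, \<open>1\<close>. With
  \<open>n = s * (2 * h + 1)\<close> the number of ones is \<open>(h + 1) + (s - 1) * h = (n - s) / 2 + 1\<close>.
\<close>

lemma inverse_of_known_weight:
  fixes n k s :: nat
  assumes "n \<ge> 1" and s: "s = gcd n k" and "odd (n div s)"
  obtains t where "0 < t" "t \<le> 2 ^ n - 1" "[(2 ^ k + 1) * t = 1] (mod (2 ^ n - 1))"
    "2 * wt t + s = n + 2"
proof -
  let ?N = "n div s" and ?\<phi> = "\<lambda>(j, m). (j + k * m) mod n"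
  obtain h where h: "?N = 2 * h + 1" using assms(3) by (elim oddE)
  have "s > 0" using assms by simp
  then obtain s' where s': "s = Suc s'" using gr0_implies_Suc by blast
  define E where "E = {m. m < ?N \<and> even m}"
  define D where "D = {m. m < ?N \<and> odd m}"
  define A where "A = ({s'} \<times> E) \<union> ({..<s'} \<times> D)"
  define B where "B = ?\<phi> ` A"
  define t :: nat where "t = (\<Sum>i\<in>B. 2 ^ i)"
  have fin: "finite E" "finite D" by (simp_all add: E_def D_def)
  have bij: "bij_betw ?\<phi> ({..<s} \<times> {..<?N}) {..<n}"
    unfolding s by (rule bij_betw_cosets [OF assms(1)])
  have A: "A \<subseteq> {..<s} \<times> {..<?N}" by (auto simp: A_def E_def D_def s')
  have inj: "inj_on ?\<phi> A" using bij A by (meson bij_betw_def inj_on_subset)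
  have B: "B \<subseteq> {..<n}" using bij A unfolding B_def by (metis bij_betw_def image_mono)

  have "card A = (h + 1) + s' * h"
    using fin by (subst A_def, subst card_Un_disjoint)
      (auto simp: E_def D_def h card_cartesian_product card_even_odd_below [simplified])
  moreover have "card B = card A" unfolding B_def by (rule card_image [OF inj])
  moreover have "n = s * (2 * h + 1)" using h s by (metis dvd_mult_div_cancel gcd_dvd1)
  ultimately have "2 * wt t + s = n + 2"
    unfolding t_def by (simp add: wt_sum_powers_of_two [OF B] s' algebra_simps)

  let ?M = "2 ^ n - 1 :: int" and ?y = "2 ^ k :: int"
  \<comment> \<open>Reducing the positions modulo \<open>n\<close> does not change the residue, so \<open>t\<close> may be computed with the
     unreduced exponents \<open>j + k * m\<close>, where sums over rectangles factor.\<close>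
  have reduce: "[(\<Sum>i\<in>?\<phi> ` C. 2 ^ i) = (\<Sum>(j, m)\<in>C. 2 ^ j * ?y ^ m)] (mod ?M)"
    if "inj_on ?\<phi> C" for C
  proof -
    have "(\<Sum>i\<in>?\<phi> ` C. (2::int) ^ i) = (\<Sum>c\<in>C. 2 ^ (?\<phi> c))"
      by (simp add: sum.reindex [OF that])
    also have "[(\<Sum>c\<in>C. 2 ^ (?\<phi> c)) = (\<Sum>(j, m)\<in>C. 2 ^ j * ?y ^ m)] (mod ?M)"
      by (intro cong_sum)
        (auto simp flip: power_mult power_add intro: cong_sym [OF cong_two_power_mod])
    finally show ?thesis .
  qed
  have factor: "(\<Sum>(j, m)\<in>J \<times> L. 2 ^ j * ?y ^ m) = (\<Sum>j\<in>J. 2 ^ j) * (\<Sum>m\<in>L. ?y ^ m)"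
    for J L :: "nat set"
    by (simp add: sum_product sum.cartesian_product)
  define G where "G = (\<Sum>m<?N. ?y ^ m)"
  have pow: "(\<Sum>i<l. (2::int) ^ i) = 2 ^ l - 1" for l by (induction l) simp_all
  have "(\<Sum>i\<in>?\<phi> ` ({..<s} \<times> {..<?N}). 2 ^ i) = ?M"
    using bij pow [of n] by (simp add: bij_betw_def)
  moreover have "[(\<Sum>i\<in>?\<phi> ` ({..<s} \<times> {..<?N}). 2 ^ i)
      = (\<Sum>(j, m)\<in>{..<s} \<times> {..<?N}. 2 ^ j * ?y ^ m)] (mod ?M)"
    by (rule reduce) (use bij in \<open>simp add: bij_betw_def\<close>)
  moreover have "(\<Sum>(j, m)\<in>{..<s} \<times> {..<?N}. 2 ^ j * ?y ^ m) = (2 ^ s - 1) * G"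
    by (simp add: G_def factor pow)
  ultimately have allones: "[(2 ^ s - 1) * G = 0] (mod ?M)"
    by (simp add: cong_sym_eq cong_def)

  have "int t = (\<Sum>i\<in>B. 2 ^ i)" by (simp add: t_def)
  then have "int ((2 ^ k + 1) * t) = (?y + 1) * (\<Sum>i\<in>B. 2 ^ i)"
    by (simp only: of_nat_mult of_nat_add of_nat_power of_nat_numeral of_nat_1)
  also have "[\<dots> = (?y + 1) * (\<Sum>(j, m)\<in>A. 2 ^ j * ?y ^ m)] (mod ?M)"
    unfolding B_def by (intro cong_mult cong_refl reduce inj)
  also have "(\<Sum>(j, m)\<in>A. 2 ^ j * ?y ^ m)
      = 2 ^ s' * (\<Sum>m\<in>E. ?y ^ m) + (2 ^ s' - 1) * (\<Sum>m\<in>D. ?y ^ m)"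
    unfolding A_def using fin
    by (subst sum.union_disjoint) (auto simp: factor pow)
  also have "(?y + 1) * \<dots>
      = 2 ^ s' * ((?y + 1) * (\<Sum>m\<in>E. ?y ^ m)) + (2 ^ s' - 1) * ((?y + 1) * (\<Sum>m\<in>D. ?y ^ m))"
    by (simp add: algebra_simps)
  also have "\<dots> = 2 ^ s' * (G + ?y ^ ?N) + (2 ^ s' - 1) * (G - 1)"
    unfolding E_def D_def G_def h by (simp only: alternating_geometric_sums)
  \<comment> \<open>\<open>2 ^ s = 2 ^ s' + 2 ^ s'\<close> collects the multiples of \<open>G\<close> into one copy of all cycles.\<close>
  also have "\<dots> = (2 ^ s - 1) * G + (2 ^ s' * (?y ^ ?N - 1) + 1)"
    by (simp add: s' algebra_simps)
  also have "[\<dots> = 0 + (2 ^ s' * (1 - 1) + 1)] (mod ?M)"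
  proof (intro cong_add allones cong_mult cong_diff cong_refl)
    have "n dvd k * ?N" using s by (metis div_mult_swap dvd_div_mult dvd_triv_right gcd_dvd1 gcd_dvd2)
    then show "[?y ^ ?N = 1] (mod ?M)"
      using cong_two_power_mod [of "k * ?N" n] by (simp add: power_mult dvd_imp_mod_0)
  qed
  finally have "[int ((2 ^ k + 1) * t) = int 1] (mod int (2 ^ n - 1))"
    by (simp add: of_nat_diff)
  then have "[(2 ^ k + 1) * t = 1] (mod (2 ^ n - 1))" by (simp only: cong_int_iff)
  moreover have "t \<le> 2 ^ n - 1" unfolding t_def by (rule sum_powers_of_two_le [OF B])
  moreover have "0 < t"
  proof -
    have "finite B" using B finite_subset by blast
    moreover have "card B > 0" using \<open>card A = _\<close> \<open>card B = card A\<close> by simp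
    ultimately show ?thesis unfolding t_def by (intro sum_pos) auto
  qed
  ultimately show ?thesis using that \<open>2 * wt t + s = n + 2\<close> by blast
qed

section \<open>Binary sequences\<close>

lemma represents_append:
  assumes "represents u l x" "represents v l' y"
  shows "represents (u @ v) (l + l') (x * 2 ^ l' + y)"
proof -
  have len: "length u = l" "length v = l'" using assms by (simp_all add: represents_def)
  have split: "(\<Sum>i<l + l'. f i) = (\<Sum>i<l'. f i) + (\<Sum>i<l. f (i + l'))" for f :: "nat \<Rightarrow> real"
    by (induction l) (simp_all add: algebra_simps)
  let ?f = "\<lambda>i. of_bool ((u @ v) ! (l + l' - 1 - i)) * 2 ^ i :: real"
  have "(\<Sum>i<l + l'. ?f i) = (\<Sum>i<l'. ?f i) + (\<Sum>i<l. ?f (i + l'))"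
    by (rule split)
  also have "(\<Sum>i<l'. ?f i) = y"
    using assms(2) len unfolding represents_def by (auto intro!: sum.cong simp: nth_append)
  also have "(\<Sum>i<l. ?f (i + l')) = x * 2 ^ l'"
    using assms(1) len unfolding represents_def sum_distrib_right
    by (auto intro!: sum.cong simp: nth_append power_add sum_distrib_right)
  finally show ?thesis using len by (simp add: represents_def)
qed

text \<open>A sequence and its complement add up, without carries, to a sequence of ones.\<close>

lemma represents_complement:
  assumes "represents v l x"
  shows "represents (complement v) l (2 ^ l - 1 - x)"
proof -
  have pow: "(\<Sum>i<l. 2 ^ i) = (2 ^ l - 1 :: real)" by (induction l) simp_all
  have "(\<Sum>i<l. of_bool (complement v ! (l - 1 - i)) * 2 ^ i)
      = (\<Sum>i<l. (2 ^ i - of_bool (v ! (l - 1 - i)) * 2 ^ i :: real))"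
    using assms by (intro sum.cong) (auto simp: represents_def complement_def)
  then show ?thesis
    using assms unfolding represents_def by (simp only: sum_subtractf pow) (simp add: complement_def)
qed

lemma represents_exists:
  assumes "x < 2 ^ l"
  shows "\<exists>v. represents v l (real x)"
  using assms
proof (induction l arbitrary: x)
  case 0
  then show ?case by (simp add: represents_def)
next
  case (Suc l)
  then obtain v where "represents v l (real (x div 2))" by (metis less_mult_imp_div_less power_Suc2)
  moreover have "represents [odd x] 1 (of_bool (odd x))" by (simp add: represents_def)
  ultimately have "represents (v @ [odd x]) (l + 1) (real (x div 2) * 2 ^ 1 + of_bool (odd x))"
    by (rule represents_append)
  moreover have "real (x div 2) * 2 ^ 1 + of_bool (odd x) = real x"
  proof -
    have "x = x div 2 * 2 + of_bool (odd x)" by (metis div_mult_mod_eq mod_2_eq_odd)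
    then show ?thesis by (metis of_nat_add of_nat_mult of_nat_numeral of_nat_of_bool power_one_right)
  qed
  ultimately show ?case by auto
qed

lemma represents_concat_replicate:
  assumes "represents v l x"
  shows "represents (concat (replicate m v)) (l * m) (x * (\<Sum>j<m. (2 ^ l) ^ j))"
proof (induction m)
  case 0
  show ?case by (simp add: represents_def)
next
  case (Suc m)
  from represents_append [OF assms this] show ?case
    by (simp add: power_mult algebra_simps)
qed

lemma wt_seq_append: "wt_seq (u @ v) = wt_seq u + wt_seq v"
  by (simp add: wt_seq_def)

lemma wt_seq_complement: "wt_seq v + wt_seq (complement v) = length v"
  by (induction v) (auto simp: wt_seq_def complement_def)

lemma wt_seq_concat_replicate: "wt_seq (concat (replicate m v)) = m * wt_seq v"
  by (induction m) (auto simp: wt_seq_def)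

section \<open>From the residue to the exponent\<close>

text \<open>
  If \<open>2 * k\<close> divided \<open>n\<close>, then \<open>gcd n k = k\<close> and the quotient \<open>n div k\<close> would be even. Hence the least
  positive residue never takes the value \<open>2 * k\<close>.
\<close>

lemma least_positive_residue:
  fixes n k :: nat
  assumes "k \<ge> 1" "odd (n div gcd n k)"
  shows "(LEAST m. 0 < m \<and> [m = n] (mod (2 * k))) = n mod (2 * k)" and "0 < n mod (2 * k)"
proof -
  show pos: "0 < n mod (2 * k)"
  proof (rule ccontr)
    assume "\<not> 0 < n mod (2 * k)"
    then obtain c where c: "n = 2 * k * c" by (auto simp: mod_eq_0_iff_dvd)
    then have "gcd n k = k" by simp
    with c assms show False by (simp add: mult.assoc)
  qed
  show "(LEAST m. 0 < m \<and> [m = n] (mod (2 * k))) = n mod (2 * k)"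
    by (rule Least_equality) (use pos in \<open>auto simp: cong_def\<close>, metis mod_less_eq_dividend)
qed

theorem theorem3p7:
  fixes n k s r :: nat and q :: real
  assumes "n \<ge> 1" and "k \<ge> 1"
    and "gcd n k = s" and "odd (n div s)"
    and "r = (LEAST m. 0 < m \<and> [m = n] (mod (2 * k)))"
    and "q = ((2 ^ k + 1) * real (Inv (2 ^ k + 1) r) - 1) / (2 ^ r - 1)"
  shows "real (Inv (2 ^ k + 1) n) =
           real (Inv (2 ^ k + 1) r) * 2 ^ (n - r)
           + (q - 1) * (2 ^ k - 1) * ((2 ^ (n - r) - 1) / (2 ^ (2 * k) - 1))
    \<and> (\<exists>g w a. represents g n (real (Inv (2 ^ k + 1) n))
          \<and> represents w k (q - 2)
          \<and> represents a r (real (Inv (2 ^ k + 1) r))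
          \<and> g = a @ concat (replicate ((n - r) div (2 * k)) (w @ complement w))
          \<and> real (wt_seq g) = real (wt_seq a) + (real n - real r) / 2)
    \<and> real (wt (Inv (2 ^ k + 1) n)) = (real n - real s) / 2 + 1
    \<and> (real n - real s) / 2 + 1 = (real n - real s + 2) / 2"
proof -
  have r: "r = n mod (2 * k)" and "r > 0"
    using least_positive_residue [of k n] assms by simp_all
  define m where "m = n div (2 * k)"
  have n: "n = 2 * k * m + r" by (simp add: m_def r)
  have "gcd r k = s"
    using assms(3) unfolding n by (metis add.commute gcd.commute gcd_add_mult mult.assoc mult.commute)
  then have "s dvd k" "s dvd r" "s > 0" using \<open>k \<ge> 1\<close> by auto
  have "n div s = 2 * (k div s) * m + r div s"
  proof -
    obtain k' r' where "k = s * k'" "r = s * r'" using \<open>s dvd k\<close> \<open>s dvd r\<close> by (elim dvdE)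
    moreover from this have "n = s * (2 * k' * m + r')" unfolding n by (simp add: algebra_simps)
    ultimately show ?thesis using \<open>s > 0\<close> by simp
  qed
  then have "odd (r div s)" using assms(4) by simp

  \<comment> \<open>As \<open>n\<close> and \<open>r\<close> differ by a multiple of \<open>2 * k\<close>, both the gcd with \<open>k\<close> and the parity of the
     quotient agree, so the existence result applies to \<open>r\<close> too.\<close>
  obtain a :: nat where a: "0 < a" "a \<le> 2 ^ r - 1" "[(2 ^ k + 1) * a = 1] (mod (2 ^ r - 1))"
    using inverse_of_known_weight [of r s k] \<open>r > 0\<close> \<open>gcd r k = s\<close> \<open>odd (r div s)\<close> by auto
  have Inv_r: "Inv (2 ^ k + 1) r = a" by (rule Inv_eqI) fact+
  obtain Q where Q: "(2 ^ k + 1) * a = 1 + Q * (2 ^ r - 1)"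
  proof -
    have "2 ^ r - 1 dvd (2 ^ k + 1) * a - 1"
      using a by (subst (asm) cong_altdef_nat) auto
    then obtain Q where "(2 ^ k + 1) * a - 1 = (2 ^ r - 1) * Q" by (elim dvdE)
    with a that [of Q] show ?thesis by (simp add: algebra_simps)
  qed
  have "2 ^ r > (1::nat)" using \<open>r > 0\<close> by (intro one_less_power) simp_all
  have "Q \<noteq> 0"
  proof
    assume "Q = 0"
    then have "2 ^ k + 1 dvd (1::nat)" using Q by (metis add_0_right dvd_triv_left mult_0)
    then show False by simp
  qed
  \<comment> \<open>For \<open>Q = 1\<close> the odd number \<open>2 ^ k + 1 > 1\<close> would divide \<open>2 ^ r\<close>.\<close>
  have "Q \<noteq> 1"
  proof
    assume "Q = 1"
    then have "(2 ^ k + 1) * a = 2 ^ r" using Q by simp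
    then have "2 ^ k + 1 dvd (2 ^ r :: nat)" by (metis dvd_triv_left)
    moreover have "coprime (2 ^ k + 1) (2 ^ r :: nat)" using \<open>k \<ge> 1\<close> by simp
    ultimately have "is_unit (2 ^ k + 1 :: nat)" using coprime_absorb_left by blast
    then show False by simp
  qed
  with \<open>Q \<noteq> 0\<close> have "Q \<ge> 2" by simp
  have "Q \<le> 2 ^ k"
  proof -
    have "Q * (2 ^ r - 1) < (2 ^ k + 1) * a" using Q by simp
    also have "\<dots> \<le> (2 ^ k + 1) * (2 ^ r - 1)" using a by (intro mult_left_mono) auto
    finally have "Q < 2 ^ k + 1" by (simp only: mult_less_cancel2)
    then show ?thesis by simp
  qed
  have Qr: "(2 ^ k + 1) * real a = 1 + real Q * (2 ^ r - 1)"
    using arg_cong [OF Q, of real] by (simp add: of_nat_diff algebra_simps)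
  have "(2::real) ^ r - 1 \<noteq> 0" using one_less_power [of "2::real" r] \<open>r > 0\<close> by linarith
  then have q: "q = real Q" unfolding assms(6) Inv_r Qr by simp

  \<comment> \<open>The factor \<open>M\<close> is the quotient \<open>(2 ^ (n - r) - 1) / (2 ^ (2 * k) - 1)\<close> as a natural number, and
     \<open>X\<close> is the claimed value of the inverse.\<close>
  define M where "M = (\<Sum>j<m. ((2::nat) ^ (2 * k)) ^ j)"
  have M: "real M * (2 ^ (2 * k) - 1) = 2 ^ (2 * k * m) - 1"
    using power_diff_1_eq [of "(2::real) ^ (2 * k)" m] by (simp add: M_def mult.commute flip: power_mult)
  define X where "X = a * 2 ^ (2 * k * m) + (Q - 1) * (2 ^ k - 1) * M"
  have X: "real X = real a * 2 ^ (2 * k * m) + (real Q - 1) * (2 ^ k - 1) * real M"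
    using \<open>Q \<ge> 2\<close> by (simp add: X_def of_nat_diff)
  \<comment> \<open>\<open>(2 ^ k + 1) * (2 ^ k - 1) = 2 ^ (2 * k) - 1\<close> cancels the denominator of \<open>M\<close>; then the terms
     without \<open>Q * 2 ^ n\<close> collapse to \<open>1 - Q\<close>.\<close>
  have "(2 ^ k + 1) * real X = 1 + real Q * (2 ^ n - 1)"
  proof -
    have "(2 ^ k + 1) * real X
        = ((2 ^ k + 1) * real a) * 2 ^ (2 * k * m) + (real Q - 1) * (real M * (2 ^ (2 * k) - 1))"
      unfolding X power_mult [of _ 2] by (simp add: power2_eq_square algebra_simps flip: power_mult_distrib)
    then show ?thesis
      unfolding Qr M by (simp add: n algebra_simps power_add)
  qed
  then have "real ((2 ^ k + 1) * X) = real (1 + Q * (2 ^ n - 1))" by (simp add: of_nat_diff algebra_simps)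
  then have QX: "(2 ^ k + 1) * X = 1 + Q * (2 ^ n - 1)" by (simp only: of_nat_eq_iff)
  have Inv_n: "Inv (2 ^ k + 1) n = X"
  proof (rule Inv_eqI)
    show "0 < X" using a by (simp add: X_def)
    have "(2 ^ k + 1) * X \<le> 1 + 2 ^ k * (2 ^ n - 1)" unfolding QX using \<open>Q \<le> 2 ^ k\<close> by simp
    also have "\<dots> \<le> (2 ^ k + 1) * (2 ^ n - 1)" using \<open>n \<ge> 1\<close> self_le_power[of "2::nat" n] by simp
    finally show "X \<le> 2 ^ n - 1" by (simp del: mult_Suc)
    show "[(2 ^ k + 1) * X = 1] (mod (2 ^ n - 1))" unfolding QX by (simp only: cong_def mod_mult_self1)
  qed

  have nr: "n - r = 2 * k * m" "(n - r) div (2 * k) = m" using n \<open>k \<ge> 1\<close> by simp_all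
  have "(2::real) ^ (2 * k) - 1 \<noteq> 0"
    using one_less_power [of "2::real" "2 * k"] \<open>k \<ge> 1\<close> by linarith
  then have M': "real M = (2 ^ (n - r) - 1) / (2 ^ (2 * k) - 1)"
    using M unfolding nr by (simp add: field_simps)

  obtain as where as: "represents as r (real a)"
  proof -
    have "a < 2 ^ r" using a(2) \<open>2 ^ r > (1::nat)\<close> by linarith
    then show ?thesis using represents_exists that by blast
  qed
  obtain w where "represents w k (real (Q - 2))"
  proof -
    have "Q - 2 < 2 ^ k" using \<open>Q \<le> 2 ^ k\<close> \<open>Q \<ge> 2\<close> by linarith
    then show ?thesis using represents_exists that by blast
  qed
  then have w: "represents w k (real Q - 2)" using \<open>Q \<ge> 2\<close> by (simp add: of_nat_diff)
  define g where "g = as @ concat (replicate m (w @ complement w))"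
  have "represents (w @ complement w) (2 * k) ((real Q - 1) * (2 ^ k - 1))"
  proof -
    have "(real Q - 2) * 2 ^ k + (2 ^ k - 1 - (real Q - 2)) = (real Q - 1) * (2 ^ k - 1)"
      by (simp add: algebra_simps)
    then show ?thesis
      using represents_append [OF w represents_complement [OF w]] by (simp only: mult_2)
  qed
  from represents_append [OF as represents_concat_replicate [OF this]]
  have g: "represents g n (real X)"
    unfolding g_def X by (simp add: M_def n add.commute)
  \<comment> \<open>A block of \<open>w\<close> and its complement has exactly \<open>k\<close> ones among its \<open>2 * k\<close> digits.\<close>
  have wt_g: "real (wt_seq g) = real (wt_seq as) + (real n - real r) / 2"
    using w by (simp add: g_def wt_seq_append wt_seq_concat_replicate wt_seq_complement n represents_def)

  obtain t where t: "0 < t" "t \<le> 2 ^ n - 1" "[(2 ^ k + 1) * t = 1] (mod (2 ^ n - 1))"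
    and wt: "2 * wt t + s = n + 2"
    using inverse_of_known_weight [of n s k] assms by auto
  have "Inv (2 ^ k + 1) n = t" by (rule Inv_eqI) fact+
  with wt have "2 * real (wt (Inv (2 ^ k + 1) n)) + real s = real n + 2" by simp
  then have "real (wt (Inv (2 ^ k + 1) n)) = (real n - real s) / 2 + 1" by (simp add: field_simps)
  moreover have "real (Inv (2 ^ k + 1) n) = real (Inv (2 ^ k + 1) r) * 2 ^ (n - r)
      + (q - 1) * (2 ^ k - 1) * ((2 ^ (n - r) - 1) / (2 ^ (2 * k) - 1))"
    unfolding Inv_n Inv_r q X M' nr ..
  moreover have "\<exists>g w a. represents g n (real (Inv (2 ^ k + 1) n)) \<and> represents w k (q - 2)
      \<and> represents a r (real (Inv (2 ^ k + 1) r))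
      \<and> g = a @ concat (replicate ((n - r) div (2 * k)) (w @ complement w))
      \<and> real (wt_seq g) = real (wt_seq a) + (real n - real r) / 2"
    using g w as wt_g unfolding Inv_n Inv_r q nr(2) g_def by blast
  ultimately show ?thesis by simp
qed

end
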